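(* Let $R$ be a Bézout ring. Then the following are equivalent: (1) $R$ is feckly zero-adequate. (2) $R/J(R)$ is regular. (3) $R/J(R)$ is $\pi$-regular.
   Context: All rings are commutative with identity. $J(R)$ denotes the Jacobson radical of $R$. A ring is a Bézout ring if every finitely generated ideal is principal. An element $c\in R$ is feckly adequate if for every $a\in R$ there exist $r,s\in R$ such that (i) $c\equiv rs \pmod{J(R)}$; (ii) $rR+aR=R$; (iii) $s'R+aR\neq R$ for each non-invertible divisor $s'$ of $s$ (i.e. each non-unit $s'\in R$ with $s\in s'R$). A feckly zero-adequate ring is a Bézout ring $R$ in which $0\in R$ is feckly adequate. A ring $S$ is (von Neumann) regular if for every $a\in S$ there is $b\in S$ with $a=aba$. A ring $S$ is $\pi$-regular if for every $a\in S$ there exist $n\in\mathbb{N}=\{1,2,3,\dots\}$ and $b\in S$ with $a^n=a^nba^n$. *)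

theory Defs
  imports "HOL-Algebra.Algebra"
begin

text \<open>
  Intersecting with the carrier makes the radical of the zero ring, which has no
  maximal ideals, the whole ring.
\<close>
definition jacobson_radical :: "('a, 'b) ring_scheme \<Rightarrow> 'a set"
  where "jacobson_radical R = carrier R \<inter> \<Inter>{M. maximalideal M R}"

locale bezout_ring = cring +
  assumes finitely_generated_principal:
    "\<lbrakk>finite A; A \<subseteq> carrier R\<rbrakk> \<Longrightarrow> principalideal (Idl A) R"

definition feckly_adequate :: "('a, 'b) ring_scheme \<Rightarrow> 'a \<Rightarrow> bool"
  where "feckly_adequate R c \<longleftrightarrow>
    (\<forall>a\<in>carrier R. \<exists>r\<in>carrier R. \<exists>s\<in>carrier R.
       c \<ominus>\<^bsub>R\<^esub> r \<otimes>\<^bsub>R\<^esub> s \<in> jacobson_radical R \<and>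
       PIdl\<^bsub>R\<^esub> r <+>\<^bsub>R\<^esub> PIdl\<^bsub>R\<^esub> a = carrier R \<and>
       (\<forall>s'\<in>carrier R - Units R. s' divides\<^bsub>R\<^esub> s \<longrightarrow>
          PIdl\<^bsub>R\<^esub> s' <+>\<^bsub>R\<^esub> PIdl\<^bsub>R\<^esub> a \<noteq> carrier R))"

locale feckly_zero_adequate_ring = bezout_ring +
  assumes zero_feckly_adequate: "feckly_adequate R \<zero>"

locale regular_ring = cring +
  assumes regular: "a \<in> carrier R \<Longrightarrow> \<exists>b\<in>carrier R. a = a \<otimes> b \<otimes> a"

locale pi_regular_ring = cring +
  assumes pi_regular:
    "a \<in> carrier R \<Longrightarrow>
       \<exists>n::nat. n \<ge> 1 \<and> (\<exists>b\<in>carrier R. a [^] n = a [^] n \<otimes> b \<otimes> a [^] n)"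

end

theory Submission
  imports Defs
begin

text \<open>
  Modulo $J$ everything can be tested at maximal ideals. Suppose $rs \in J$, $rx + ya = 1$, and no
  non-unit divisor of $s$ is comaximal with $a$. The Bezout hypothesis shows that every maximal
  ideal containing $s$ contains $a$: otherwise $m + ta = 1$ for some $m \in M$, and a generator of
  $(s, m)$ is a forbidden divisor of $s$. Hence every maximal ideal contains $a$ or $r$, so
  $ar \in J$ and $a \equiv aya$. Conversely, if $a \equiv aba$, then $r = 1 - ab$ and $s = a$
  witness adequacy of $0$. Finally, $\pi$-regularity gives regularity because maximal ideals are
  prime, so $a^n(1 - ba^n) \in J$ forces $a(1 - ba^n) \in J$.
\<close>

context cring
begin

lemma ideal_jacobson_radical: "ideal (jacobson_radical R) R"
proof -
  \<comment> \<open>Putting \<open>carrier R\<close> into the family makes it nonempty, as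
    \<open>i_Intersect\<close> requires, also for the zero ring, which has no maximal
    ideals.\<close>
  have "jacobson_radical R = \<Inter> (insert (carrier R) {M. maximalideal M R})"
    by (auto simp: jacobson_radical_def)
  moreover have "ideal (\<Inter> (insert (carrier R) {M. maximalideal M R})) R"
    by (rule i_Intersect) (auto intro: oneideal maximalideal.axioms(1))
  ultimately show ?thesis by simp
qed

lemma mem_jacobson_radical_iff:
  "x \<in> jacobson_radical R \<longleftrightarrow> x \<in> carrier R \<and> (\<forall>M. maximalideal M R \<longrightarrow> x \<in> M)"
  by (auto simp: jacobson_radical_def)

text \<open>An ideal containing \<open>\<one>\<close> is the whole ring, so comaximality amounts to
  a Bezout identity, whose coefficients the later arguments compute with.\<close>

lemma PIdl_add_PIdl_eq_carrier_iff:
  assumes "a \<in> carrier R" "b \<in> carrier R"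
  shows "PIdl a <+>\<^bsub>R\<^esub> PIdl b = carrier R \<longleftrightarrow>
    (\<exists>x\<in>carrier R. \<exists>y\<in>carrier R. x \<otimes> a \<oplus> y \<otimes> b = \<one>)"
proof -
  interpret I: ideal "PIdl a <+>\<^bsub>R\<^esub> PIdl b" R
    using assms by (intro add_ideals cgenideal_ideal)
  have "PIdl a <+>\<^bsub>R\<^esub> PIdl b = carrier R \<longleftrightarrow> \<one> \<in> PIdl a <+>\<^bsub>R\<^esub> PIdl b"
    using I.one_imp_carrier by auto
  also have "\<dots> \<longleftrightarrow> (\<exists>x\<in>carrier R. \<exists>y\<in>carrier R. x \<otimes> a \<oplus> y \<otimes> b = \<one>)"
    unfolding set_add_def' cgenideal_def by (auto; metis)
  finally show ?thesis .
qed

lemma ball_carrier_Quot_iff: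
  "(\<forall>A\<in>carrier (R Quot I). P A) \<longleftrightarrow> (\<forall>a\<in>carrier R. P (I +> a))"
  by (auto simp: FactRing_def A_RCOSETS_def')

text \<open>Cosets agree exactly when their representatives differ by an element of
  \<open>I\<close>. Leaving \<open>x\<close> arbitrary covers both \<open>a\<close> for regularity
  and \<open>a [^] n\<close> for \<pi>-regularity.\<close>

lemma Quot_regular_iff:
  assumes "ideal I R" and x: "x \<in> carrier R"
  shows "(\<exists>B\<in>carrier (R Quot I). I +> x = (I +> x) \<otimes>\<^bsub>R Quot I\<^esub> B \<otimes>\<^bsub>R Quot I\<^esub> (I +> x)) \<longleftrightarrow>
    (\<exists>b\<in>carrier R. x \<ominus> x \<otimes> b \<otimes> x \<in> I)"
proof -
  interpret I: ideal I R by fact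
  have "I +> x = (I +> x) \<otimes>\<^bsub>R Quot I\<^esub> (I +> b) \<otimes>\<^bsub>R Quot I\<^esub> (I +> x) \<longleftrightarrow> x \<ominus> x \<otimes> b \<otimes> x \<in> I"
    if "b \<in> carrier R" for b
    using x that quotient_eq_iff_same_a_r_cos[OF assms(1), of x "x \<otimes> b \<otimes> x"]
    by (simp add: FactRing_def I.rcoset_mult_add)
  moreover have "carrier (R Quot I) = (\<lambda>b. I +> b) ` carrier R"
    by (auto simp: FactRing_def A_RCOSETS_def')
  ultimately show ?thesis by auto
qed

lemma regular_ring_Quot_iff:
  assumes "ideal I R"
  shows "regular_ring (R Quot I) \<longleftrightarrow> (\<forall>a\<in>carrier R. \<exists>b\<in>carrier R. a \<ominus> a \<otimes> b \<otimes> a \<in> I)"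
proof -
  have "regular_ring (R Quot I) \<longleftrightarrow> (\<forall>A\<in>carrier (R Quot I). \<exists>B\<in>carrier (R Quot I).
      A = A \<otimes>\<^bsub>R Quot I\<^esub> B \<otimes>\<^bsub>R Quot I\<^esub> A)"
    using ideal.quotient_is_cring[OF assms is_cring]
    unfolding regular_ring_def regular_ring_axioms_def by blast
  then show ?thesis
    using Quot_regular_iff[OF assms] by (simp add: ball_carrier_Quot_iff)
qed

lemma pi_regular_ring_Quot_iff:
  assumes "ideal I R"
  shows "pi_regular_ring (R Quot I) \<longleftrightarrow> (\<forall>a\<in>carrier R. \<exists>n::nat. n \<ge> 1 \<and>
    (\<exists>b\<in>carrier R. a [^] n \<ominus> a [^] n \<otimes> b \<otimes> a [^] n \<in> I))"
proof -
  interpret h: ring_hom_ring R "R Quot I" "(+>) I"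
    by (rule ideal.rcos_ring_hom_ring[OF assms])
  \<comment> \<open>The projection is a homomorphism, so \<pi>-regularity at the coset of
    \<open>a\<close> becomes the regularity equation at the coset of \<open>a [^] n\<close>.\<close>
  have pow: "(I +> a) [^]\<^bsub>R Quot I\<^esub> (n::nat) = I +> a [^] n" if "a \<in> carrier R" for a n
    using that by (simp add: h.hom_nat_pow)
  have "pi_regular_ring (R Quot I) \<longleftrightarrow> (\<forall>A\<in>carrier (R Quot I). \<exists>n::nat. n \<ge> 1 \<and>
      (\<exists>B\<in>carrier (R Quot I). A [^]\<^bsub>R Quot I\<^esub> n =
        A [^]\<^bsub>R Quot I\<^esub> n \<otimes>\<^bsub>R Quot I\<^esub> B \<otimes>\<^bsub>R Quot I\<^esub> A [^]\<^bsub>R Quot I\<^esub> n))"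
    using ideal.quotient_is_cring[OF assms is_cring]
    unfolding pi_regular_ring_def pi_regular_ring_axioms_def by blast
  also have "\<dots> \<longleftrightarrow> (\<forall>a\<in>carrier R. \<exists>n::nat. n \<ge> 1 \<and> (\<exists>B\<in>carrier (R Quot I). I +> a [^] n =
        (I +> a [^] n) \<otimes>\<^bsub>R Quot I\<^esub> B \<otimes>\<^bsub>R Quot I\<^esub> (I +> a [^] n)))"
    unfolding ball_carrier_Quot_iff by (simp add: pow)
  finally show ?thesis
    using Quot_regular_iff[OF assms] by simp
qed

lemma feckly_adequate_zero_if_regular_mod_jacobson_radical:
  assumes reg: "\<And>a. a \<in> carrier R \<Longrightarrow> \<exists>b\<in>carrier R. a \<ominus> a \<otimes> b \<otimes> a \<in> jacobson_radical R"
  shows "feckly_adequate R \<zero>"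
  unfolding feckly_adequate_def
proof
  fix a assume a: "a \<in> carrier R"
  interpret J: ideal "jacobson_radical R" R by (rule ideal_jacobson_radical)
  obtain b where b: "b \<in> carrier R" and ab: "a \<ominus> a \<otimes> b \<otimes> a \<in> jacobson_radical R"
    using reg[OF a] by blast
  \<comment> \<open>With \<open>s = a\<close>, the product \<open>r \<otimes> a\<close> is
    \<open>a \<ominus> a \<otimes> b \<otimes> a\<close>, hence in the radical, while
    \<open>r \<oplus> b \<otimes> a = \<one>\<close> gives comaximality.\<close>
  define r where "r = \<one> \<ominus> b \<otimes> a"
  have r: "r \<in> carrier R" using a b by (simp add: r_def)
  have "\<zero> \<ominus> r \<otimes> a = \<ominus> (a \<ominus> a \<otimes> b \<otimes> a)"
    using a b unfolding r_def by algebra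
  then have 1: "\<zero> \<ominus> r \<otimes> a \<in> jacobson_radical R"
    using ab by simp
  have "\<one> \<otimes> r \<oplus> b \<otimes> a = \<one>"
    using a b unfolding r_def by algebra
  then have 2: "PIdl r <+>\<^bsub>R\<^esub> PIdl a = carrier R"
    unfolding PIdl_add_PIdl_eq_carrier_iff[OF r a] using b by blast
  \<comment> \<open>A divisor \<open>s\<close> of \<open>a\<close> divides every
    \<open>x \<otimes> s \<oplus> y \<otimes> a\<close>; if one of these is \<open>\<one>\<close>,
    then \<open>s\<close> is a unit.\<close>
  have 3: "PIdl s <+>\<^bsub>R\<^esub> PIdl a \<noteq> carrier R"
    if s: "s \<in> carrier R - Units R" "s divides a" for s
  proof
    assume "PIdl s <+>\<^bsub>R\<^esub> PIdl a = carrier R"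
    then obtain x y where xy: "x \<in> carrier R" "y \<in> carrier R" "x \<otimes> s \<oplus> y \<otimes> a = \<one>"
      using s a PIdl_add_PIdl_eq_carrier_iff[of s a] by auto
    obtain c where c: "c \<in> carrier R" "a = s \<otimes> c"
      using s by (auto elim: dividesE)
    have "s \<in> carrier R" using s by simp
    then have "s \<otimes> (x \<oplus> y \<otimes> c) = x \<otimes> s \<oplus> y \<otimes> a"
      unfolding c(2) using xy(1,2) c(1) by algebra
    then have "s divides \<one>"
      using xy c(1) by (intro dividesI[of "x \<oplus> y \<otimes> c"]) auto
    then show False
      using s Unit_eq_dividesone[of s] by simp
  qed
  show "\<exists>r\<in>carrier R. \<exists>s\<in>carrier R. \<zero> \<ominus> r \<otimes> s \<in> jacobson_radical R \<and>
       PIdl r <+>\<^bsub>R\<^esub> PIdl a = carrier R \<and>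
       (\<forall>s'\<in>carrier R - Units R. s' divides s \<longrightarrow> PIdl s' <+>\<^bsub>R\<^esub> PIdl a \<noteq> carrier R)"
    using r a 1 2 3 by blast
qed

lemma regular_mod_jacobson_radical_if_pi_regular:
  fixes n :: nat
  assumes a: "a \<in> carrier R" and b: "b \<in> carrier R" and "n \<ge> 1"
    and J: "a [^] n \<ominus> a [^] n \<otimes> b \<otimes> a [^] n \<in> jacobson_radical R"
  shows "\<exists>c\<in>carrier R. a \<ominus> a \<otimes> c \<otimes> a \<in> jacobson_radical R"
proof -
  obtain k where n: "n = Suc k" using \<open>n \<ge> 1\<close> by (cases n) auto
  \<comment> \<open>As \<open>n \<ge> 1\<close>, one factor \<open>a\<close> splits off
    \<open>a [^] n\<close> and \<open>c\<close> absorbs the remaining \<open>k\<close>, so that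
    \<open>b \<otimes> a [^] n = c \<otimes> a\<close>.\<close>
  define c where "c = b \<otimes> a [^] k"
  have c: "c \<in> carrier R" using a b by (simp add: c_def)
  have ca: "b \<otimes> a [^] n = c \<otimes> a"
    using a b by (simp add: n c_def m_assoc)
  have "a \<ominus> a \<otimes> c \<otimes> a \<in> M" if "maximalideal M R" for M
  proof -
    interpret M: maximalideal M R by fact
    interpret P: primeideal M R using M.is_maximalideal maximalideal_prime by blast
    have eq: "a \<ominus> a \<otimes> c \<otimes> a = a \<otimes> (\<one> \<ominus> c \<otimes> a)"
      using a c by algebra
    have "a [^] n \<ominus> a [^] n \<otimes> b \<otimes> a [^] n = a [^] n \<otimes> (\<one> \<ominus> b \<otimes> a [^] n)"
      using a b nat_pow_closed[OF a, of n] by algebra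
    then have "a [^] n \<otimes> (\<one> \<ominus> c \<otimes> a) \<in> M"
      using J that by (simp add: mem_jacobson_radical_iff ca)
    then consider "a [^] n \<in> M" | "\<one> \<ominus> c \<otimes> a \<in> M"
      using P.I_prime[of "a [^] n" "\<one> \<ominus> c \<otimes> a"] a c by auto
    then show ?thesis
    proof cases
      case 1
      \<comment> \<open>Primality strips off one factor at a time; at exponent 0 the premise reads
        \<open>\<one> \<in> M\<close>, impossible in a proper ideal.\<close>
      have "a [^] m \<in> M \<Longrightarrow> a \<in> M" for m :: nat
      proof (induction m)
        case 0
        then show ?case using M.one_imp_carrier P.I_notcarr by simp
      next
        case (Suc m)
        then show ?case using a P.I_prime[of "a [^] m" a] by auto
      qed
      with 1 have "a \<in> M" by blast
      then show ?thesis unfolding eq using a c by (simp add: M.I_r_closed)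
    next
      case 2
      then show ?thesis unfolding eq using a by (simp add: M.I_l_closed)
    qed
  qed
  then show ?thesis
    using a c by (auto simp: mem_jacobson_radical_iff)
qed

end

lemma (in regular_ring) pi_regular_ring: "pi_regular_ring R"
proof
  fix a assume a: "a \<in> carrier R"
  then show "\<exists>n::nat. n \<ge> 1 \<and> (\<exists>b\<in>carrier R. a [^] n = a [^] n \<otimes> b \<otimes> a [^] n)"
    using regular[OF a] by (intro exI[of _ 1]) simp
qed

text \<open>Adequacy speaks of divisors of \<open>s\<close>, the radical of maximal ideals; this
  lemma links the two. A generator \<open>d\<close> of the ideal of \<open>s\<close> and some
  \<open>m \<in> M\<close> stays in \<open>M\<close>, so it is no unit, yet it inherits comaximality
  with \<open>a\<close> from \<open>m\<close>.\<close>

lemma (in bezout_ring) mem_maximalideal_if_divisors_not_comaximal: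
  assumes "maximalideal M R" and a: "a \<in> carrier R" and s: "s \<in> M"
    and nc: "\<And>d. \<lbrakk>d \<in> carrier R - Units R; d divides s\<rbrakk> \<Longrightarrow> PIdl d <+>\<^bsub>R\<^esub> PIdl a \<noteq> carrier R"
  shows "a \<in> M"
proof (rule ccontr)
  assume aM: "a \<notin> M"
  interpret M: maximalideal M R by fact
  \<comment> \<open>The sum is an ideal strictly larger than \<open>M\<close>, hence everything by
    maximality; this yields \<open>m\<close> and \<open>t\<close>.\<close>
  have "M \<subseteq> M <+>\<^bsub>R\<^esub> PIdl a" "a \<in> M <+>\<^bsub>R\<^esub> PIdl a"
  proof -
    show "M \<subseteq> M <+>\<^bsub>R\<^esub> PIdl a"
    proof
      fix x assume "x \<in> M"
      then have "x = x \<oplus> \<zero>" "\<zero> \<in> PIdl a"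
        using a additive_subgroup.zero_closed[OF ideal.axioms(1)[OF cgenideal_ideal[OF a]]]
        by (auto intro: M.Icarr)
      with \<open>x \<in> M\<close> show "x \<in> M <+>\<^bsub>R\<^esub> PIdl a" unfolding set_add_def' by blast
    qed
    have "a = \<zero> \<oplus> a" using a by simp
    then show "a \<in> M <+>\<^bsub>R\<^esub> PIdl a"
      using cgenideal_self[OF a] M.zero_closed unfolding set_add_def' by blast
  qed
  moreover have id: "ideal (M <+>\<^bsub>R\<^esub> PIdl a) R"
    by (intro add_ideals M.is_ideal cgenideal_ideal a)
  ultimately have "M <+>\<^bsub>R\<^esub> PIdl a = carrier R"
    using M.I_maximal[of "M <+>\<^bsub>R\<^esub> PIdl a"] aM additive_subgroup.a_subset[OF ideal.axioms(1)[OF id]]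
    by auto
  then have "\<one> \<in> M <+>\<^bsub>R\<^esub> PIdl a" by simp
  then obtain m t where m: "m \<in> M" and t: "t \<in> carrier R" "m \<oplus> t \<otimes> a = \<one>"
    unfolding set_add_def' cgenideal_def by auto
  have mc: "m \<in> carrier R" and sc: "s \<in> carrier R" using m s M.Icarr by auto
  \<comment> \<open>The Bezout hypothesis enters here: \<open>d\<close> is a greatest common divisor
    of \<open>s\<close> and \<open>m\<close>.\<close>
  obtain d where d: "d \<in> carrier R" "Idl {s, m} = Idl {d}"
    using principalideal.generate[OF finitely_generated_principal[of "{s, m}"]] mc sc by auto
  have "s \<in> PIdl d" "m \<in> PIdl d"
    using genideal_self[of "{s, m}"] mc sc d by (auto simp: cgenideal_eq_genideal)
  then obtain u v where u: "u \<in> carrier R" "s = u \<otimes> d" and v: "v \<in> carrier R" "m = v \<otimes> d"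
    unfolding cgenideal_def by auto
  have "Idl {s, m} \<subseteq> M"
    using m s by (intro genideal_minimal M.is_ideal) auto
  then have dM: "d \<in> M"
    using genideal_self[of "{d}"] d by auto
  have "d \<notin> Units R"
  proof
    assume "d \<in> Units R"
    then have "\<one> = inv d \<otimes> d" "inv d \<in> carrier R" by auto
    then have "\<one> \<in> M" using M.I_l_closed[OF dM] by simp
    then show False using M.one_imp_carrier M.I_notcarr by blast
  qed
  moreover have "d divides s"
    using u d by (intro dividesI[of u]) (auto simp: m_comm)
  \<comment> \<open>The identity is \<open>v \<otimes> d \<oplus> t \<otimes> a = m \<oplus> t
    \<otimes> a = \<one>\<close>.\<close>
  moreover have "PIdl d <+>\<^bsub>R\<^esub> PIdl a = carrier R"
    using PIdl_add_PIdl_eq_carrier_iff[OF d(1) a] v t by blast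
  ultimately show False using nc d(1) by blast
qed

text \<open>Multiplying \<open>x \<otimes> r \<oplus> y \<otimes> a = \<one>\<close> by
  \<open>a\<close> gives \<open>a \<ominus> a \<otimes> y \<otimes> a = x \<otimes> (a \<otimes>
  r)\<close>, so \<open>y\<close> serves as \<open>b\<close> once \<open>a \<otimes> r\<close> lies
  in the radical.\<close>

lemma (in feckly_zero_adequate_ring) regular_mod_jacobson_radical:
  assumes a: "a \<in> carrier R"
  shows "\<exists>b\<in>carrier R. a \<ominus> a \<otimes> b \<otimes> a \<in> jacobson_radical R"
proof -
  interpret J: ideal "jacobson_radical R" R by (rule ideal_jacobson_radical)
  obtain r s where r: "r \<in> carrier R" and s: "s \<in> carrier R"
    and rs: "\<zero> \<ominus> r \<otimes> s \<in> jacobson_radical R"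
    and ra: "PIdl r <+>\<^bsub>R\<^esub> PIdl a = carrier R"
    and nc: "\<And>s'. \<lbrakk>s' \<in> carrier R - Units R; s' divides s\<rbrakk> \<Longrightarrow> PIdl s' <+>\<^bsub>R\<^esub> PIdl a \<noteq> carrier R"
    using zero_feckly_adequate[unfolded feckly_adequate_def, rule_format, OF a]
    by (elim bexE conjE) simp
  obtain x y where xy: "x \<in> carrier R" "y \<in> carrier R" "x \<otimes> r \<oplus> y \<otimes> a = \<one>"
    using ra PIdl_add_PIdl_eq_carrier_iff[OF r a] by blast
  have rsJ: "r \<otimes> s \<in> jacobson_radical R"
    using J.a_inv_closed[OF rs] r s by (simp add: a_minus_def)
  have "a \<otimes> r \<in> M" if "maximalideal M R" for M
  proof -
    interpret M: maximalideal M R by fact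
    interpret P: primeideal M R using M.is_maximalideal maximalideal_prime by blast
    \<comment> \<open>Primality gives the alternative; when \<open>s \<in> M\<close>, the condition
      on divisors of \<open>s\<close> forces \<open>a \<in> M\<close>, so
      \<open>a \<otimes> r \<in> M\<close> either way.\<close>
    have "r \<in> M \<or> s \<in> M"
      using rsJ that P.I_prime[OF r s] by (simp add: mem_jacobson_radical_iff)
    then have "r \<in> M \<or> a \<in> M"
      using mem_maximalideal_if_divisors_not_comaximal[OF that a _ nc] by blast
    then show ?thesis using a r M.I_l_closed M.I_r_closed by blast
  qed
  then have "a \<otimes> r \<in> jacobson_radical R"
    using a r by (simp add: mem_jacobson_radical_iff)
  then have "x \<otimes> (a \<otimes> r) \<in> jacobson_radical R"
    using xy J.I_l_closed by blast
  moreover have "a \<ominus> a \<otimes> y \<otimes> a = x \<otimes> (a \<otimes> r)"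
  proof -
    have "a \<ominus> a \<otimes> y \<otimes> a = a \<otimes> (x \<otimes> r \<oplus> y \<otimes> a) \<ominus> a \<otimes> y \<otimes> a"
      using a xy by simp
    also have "\<dots> = x \<otimes> (a \<otimes> r)" using a xy(1,2) r by algebra
    finally show ?thesis .
  qed
  ultimately show ?thesis using xy(2) by (intro bexI[of _ y]) simp_all
qed

theorem theorem2p5:
  fixes R :: "('a, 'b) ring_scheme"
  assumes "bezout_ring R"
  shows "(feckly_zero_adequate_ring R \<longleftrightarrow> regular_ring (R Quot jacobson_radical R)) \<and>
    (regular_ring (R Quot jacobson_radical R) \<longleftrightarrow> pi_regular_ring (R Quot jacobson_radical R))"
proof -
  interpret bezout_ring R by fact
  note regular_iff = regular_ring_Quot_iff[OF ideal_jacobson_radical]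
  have "regular_ring (R Quot jacobson_radical R)" if "feckly_zero_adequate_ring R"
    using feckly_zero_adequate_ring.regular_mod_jacobson_radical[OF that] regular_iff by blast
  moreover have "feckly_zero_adequate_ring R" if "regular_ring (R Quot jacobson_radical R)"
    using that feckly_adequate_zero_if_regular_mod_jacobson_radical regular_iff
    by unfold_locales blast
  moreover have "regular_ring (R Quot jacobson_radical R)"
    if "pi_regular_ring (R Quot jacobson_radical R)"
    using that regular_mod_jacobson_radical_if_pi_regular
    unfolding regular_iff pi_regular_ring_Quot_iff[OF ideal_jacobson_radical] by blast
  \<comment> \<open>The remaining implication, regular to \<pi>-regular, is the case of exponent
    1.\<close>
  ultimately show ?thesis
    using regular_ring.pi_regular_ring by blast
qed

end
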